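(* In the vertical model described in the context, top-down matching is optimal, and the optimal matching quantities in period $t$ are fully determined by the optimal total matching quantity $Q^{t*}=\sum_{i\in\mathcal D,j\in\mathcal S}q_{ij}^{t*}$. That is, there exists an optimal policy such that in every period $t$ and every state $(\mathbf x,\mathbf y)$, with $Q^{t*}$ its total matching quantity, $$q_{ij}^{t*}=\Big(\min\{\tilde x_i,\tilde y_j,Q^{t*}\}-\max\{\tilde x_{i-1},\tilde y_{j-1}\}\Big)^+\qquad\text{for all } i\in\mathcal D,\ j\in\mathcal S,$$ where $\tilde x_i=\sum_{k=1}^ix_k$, $\tilde y_j=\sum_{k=1}^jy_k$, $\tilde x_0=\tilde y_0=0$.
   Context: Model. $T,m,n\ge1$ are integers, $\alpha,\beta\in[0,1]$, demand types $\mathcal D=\{1,\dots,m\}$, supply types $\mathcal S=\{1,\dots,n\}$, unit matching rewards $r_{ij}^t$ ($1\le t\le T$). In each period $t$ random vectors $\mathbf D^t\in\mathbb R_+^m,\mathbf S^t\in\mathbb R_+^n$ arrive; their distributions do not depend on matching decisions and have finite expectations. The state $(\mathbf x,\mathbf y)\in\mathbb R_+^m\times\mathbb R_+^n$ in period $t$ lists available quantities after the arrivals of period $t$. A feasible decision is $\mathbf Q=(q_{ij})\in\mathbb R_+^{m\times n}$ with $u_i=x_i-\sum_jq_{ij}\ge0$, $v_j=y_j-\sum_iq_{ij}\ge0$. Put $V_{T+1}\equiv0$ and for $t=T,\dots,1$ $$V_t(\mathbf x,\mathbf y)=\max_{\mathbf Q\text{ feasible}}\Big\{\sum_{i,j}r_{ij}^tq_{ij}+E\,V_{t+1}(\alpha\mathbf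 u+\mathbf D^{t+1},\beta\mathbf v+\mathbf S^{t+1})\Big\}.$$ A policy (a feasible decision for every $t$ and state) is optimal if it attains this maximum for every $t$ and every state. Vertical model. $r_{ij}^t=r_{id}^t+r_{js}^t$ with $r_{1d}^t>r_{2d}^t>\dots>r_{md}^t$ and $r_{1s}^t>r_{2s}^t>\dots>r_{ns}^t$ (smaller index means higher quality); put $r_{m+1,d}^t=r_{n+1,s}^t=0$ for all $t$. Standing assumption: for $t=1,\dots,T-1$, $i=1,\dots,m$, $j=1,\dots,n$, $r_{id}^t-r_{i+1,d}^t\ge\alpha(r_{id}^{t+1}-r_{i+1,d}^{t+1})$ and $r_{js}^t-r_{j+1,s}^t\ge\beta(r_{js}^{t+1}-r_{j+1,s}^{t+1})$. Top-down matching means: line up demand types and supply types separately in descending order of quality (ascending index) and match demand with supply from the top, down to some level, i.e. match the first $Q$ units of the demand line with the first $Q$ units of the supply line in order, where $Q$ is the total matching quantity. *)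

theory Defs
  imports "HOL-Probability.Probability"
begin

text \<open>
  Vectors in \<open>\<real>\<^sup>k\<close> and matrices in \<open>\<real>\<^sup>k\<^sup>\<times>\<^sup>l\<close> are functions on natural numbers, indexed from 1 and
  zero outside their index range, so that every vector has exactly one representation.
\<close>

definition nonneg_vecs :: "nat \<Rightarrow> (nat \<Rightarrow> real) set" where
  "nonneg_vecs k = {x. (\<forall>i\<in>{1..k}. 0 \<le> x i) \<and> (\<forall>i. i \<notin> {1..k} \<longrightarrow> x i = 0)}"

definition nonneg_mats :: "nat \<Rightarrow> nat \<Rightarrow> (nat \<Rightarrow> nat \<Rightarrow> real) set" where
  "nonneg_mats k l =
     {q. (\<forall>i\<in>{1..k}. \<forall>j\<in>{1..l}. 0 \<le> q i j) \<and>
         (\<forall>i j. i \<notin> {1..k} \<or> j \<notin> {1..l} \<longrightarrow> q i j = 0)}"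

text \<open>
  Periods are the first argument of the time-dependent fields. The arrival vectors of all periods
  live on one probability space; no independence is imposed, neither between periods nor between
  the components of the arrivals of one period.
\<close>

record 'w matching_model =
  horizon :: nat                                        (* T *)
  n_demand :: nat                                       (* m *)
  n_supply :: nat                                       (* n *)
  carry_demand :: real                                  (* alpha *)
  carry_supply :: real                                  (* beta *)
  reward :: "nat \<Rightarrow> nat \<Rightarrow> nat \<Rightarrow> real"                 (* r t i j *)
  prob_of :: "'w measure"
  demand_arr :: "nat \<Rightarrow> 'w \<Rightarrow> nat \<Rightarrow> real"                  (* D t w i *)
  supply_arr :: "nat \<Rightarrow> 'w \<Rightarrow> nat \<Rightarrow> real"                  (* S t w j *)

definition valid_model :: "'w matching_model \<Rightarrow> bool" where
  "valid_model P \<longleftrightarrow>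
     1 \<le> horizon P \<and> 1 \<le> n_demand P \<and> 1 \<le> n_supply P \<and>
     carry_demand P \<in> {0..1} \<and> carry_supply P \<in> {0..1} \<and>
     prob_space (prob_of P) \<and>
     (\<forall>t\<in>{1..horizon P}.
        (\<forall>\<omega>\<in>space (prob_of P). demand_arr P t \<omega> \<in> nonneg_vecs (n_demand P)) \<and>
        (\<forall>\<omega>\<in>space (prob_of P). supply_arr P t \<omega> \<in> nonneg_vecs (n_supply P)) \<and>
        (\<forall>i\<in>{1..n_demand P}. integrable (prob_of P) (\<lambda>\<omega>. demand_arr P t \<omega> i)) \<and>
        (\<forall>j\<in>{1..n_supply P}. integrable (prob_of P) (\<lambda>\<omega>. supply_arr P t \<omega> j)))"

definition left_demand ::
    "'w matching_model \<Rightarrow> (nat \<Rightarrow> real) \<Rightarrow> (nat \<Rightarrow> nat \<Rightarrow> real) \<Rightarrow> nat \<Rightarrow> real" where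
  "left_demand P x q = (\<lambda>i. x i - (\<Sum>j=1..n_supply P. q i j))"

definition left_supply ::
    "'w matching_model \<Rightarrow> (nat \<Rightarrow> real) \<Rightarrow> (nat \<Rightarrow> nat \<Rightarrow> real) \<Rightarrow> nat \<Rightarrow> real" where
  "left_supply P y q = (\<lambda>j. y j - (\<Sum>i=1..n_demand P. q i j))"

definition feasible ::
    "'w matching_model \<Rightarrow> (nat \<Rightarrow> real) \<Rightarrow> (nat \<Rightarrow> real) \<Rightarrow> (nat \<Rightarrow> nat \<Rightarrow> real) set" where
  "feasible P x y =
     {q \<in> nonneg_mats (n_demand P) (n_supply P).
        (\<forall>i\<in>{1..n_demand P}. 0 \<le> left_demand P x q i) \<and>
        (\<forall>j\<in>{1..n_supply P}. 0 \<le> left_supply P y q j)}"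

text \<open>
  The function being maximized in period \<open>t\<close> when \<open>W\<close> is the value function of period \<open>t + 1\<close>.
\<close>

definition objective ::
    "'w matching_model \<Rightarrow> nat \<Rightarrow> ((nat \<Rightarrow> real) \<Rightarrow> (nat \<Rightarrow> real) \<Rightarrow> real) \<Rightarrow>
     (nat \<Rightarrow> real) \<Rightarrow> (nat \<Rightarrow> real) \<Rightarrow> (nat \<Rightarrow> nat \<Rightarrow> real) \<Rightarrow> real" where
  "objective P t W x y q =
     (\<Sum>i=1..n_demand P. \<Sum>j=1..n_supply P. reward P t i j * q i j) +
     (\<integral>\<omega>. W (\<lambda>i. carry_demand P * left_demand P x q i + demand_arr P (t + 1) \<omega> i)
             (\<lambda>j. carry_supply P * left_supply P y q j + supply_arr P (t + 1) \<omega> j) \<partial>(prob_of P))"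

text \<open>
  The value function is written with a supremum; that it is a maximum is part of what the existence
  of an optimal policy (below) asserts. In a valid model, the supremum is over a bounded set and the
  expectation is of an integrable function (the value functions are Lipschitz on the nonnegative
  states). Only periods \<open>1, \<dots>, T + 1\<close> are meaningful.
\<close>

function value_fun ::
    "'w matching_model \<Rightarrow> nat \<Rightarrow> (nat \<Rightarrow> real) \<Rightarrow> (nat \<Rightarrow> real) \<Rightarrow> real" where
  "value_fun P t =
     (if horizon P < t then (\<lambda>x y. 0)
      else (\<lambda>x y. SUP q\<in>feasible P x y. objective P t (value_fun P (t + 1)) x y q))"
  by pat_completeness auto
termination
  by (relation "Wellfounded.measure (\<lambda>(P, t). Suc (horizon P) - t)") auto

declare value_fun.simps [simp del]

type_synonym policy = "nat \<Rightarrow> (nat \<Rightarrow> real) \<Rightarrow> (nat \<Rightarrow> real) \<Rightarrow> nat \<Rightarrow> nat \<Rightarrow> real"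

definition optimal_policy :: "'w matching_model \<Rightarrow> policy \<Rightarrow> bool" where
  "optimal_policy P \<pi> \<longleftrightarrow>
     (\<forall>t\<in>{1..horizon P}. \<forall>x\<in>nonneg_vecs (n_demand P). \<forall>y\<in>nonneg_vecs (n_supply P).
        \<pi> t x y \<in> feasible P x y \<and>
        (\<forall>q\<in>feasible P x y.
           objective P t (value_fun P (t + 1)) x y q
             \<le> objective P t (value_fun P (t + 1)) x y (\<pi> t x y)))"

definition vertical_rewards ::
    "'w matching_model \<Rightarrow> (nat \<Rightarrow> nat \<Rightarrow> real) \<Rightarrow> (nat \<Rightarrow> nat \<Rightarrow> real) \<Rightarrow> bool" where
  "vertical_rewards P rd rs \<longleftrightarrow>
     (\<forall>t\<in>{1..horizon P}.
        (\<forall>i\<in>{1..n_demand P}. \<forall>j\<in>{1..n_supply P}. reward P t i j = rd t i + rs t j) \<and>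
        (\<forall>i\<in>{1..<n_demand P}. rd t i > rd t (i + 1)) \<and>
        (\<forall>j\<in>{1..<n_supply P}. rs t j > rs t (j + 1)) \<and>
        rd t (n_demand P + 1) = 0 \<and> rs t (n_supply P + 1) = 0)"

definition discounted_quality_gaps ::
    "'w matching_model \<Rightarrow> (nat \<Rightarrow> nat \<Rightarrow> real) \<Rightarrow> (nat \<Rightarrow> nat \<Rightarrow> real) \<Rightarrow> bool" where
  "discounted_quality_gaps P rd rs \<longleftrightarrow>
     (\<forall>t\<in>{1..<horizon P}.
        (\<forall>i\<in>{1..n_demand P}.
           rd t i - rd t (i + 1) \<ge> carry_demand P * (rd (t + 1) i - rd (t + 1) (i + 1))) \<and>
        (\<forall>j\<in>{1..n_supply P}.
           rs t j - rs t (j + 1) \<ge> carry_supply P * (rs (t + 1) j - rs (t + 1) (j + 1))))"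

definition cum :: "(nat \<Rightarrow> real) \<Rightarrow> nat \<Rightarrow> real" where
  "cum x i = (\<Sum>k=1..i. x k)"

definition total_quantity :: "'w matching_model \<Rightarrow> (nat \<Rightarrow> nat \<Rightarrow> real) \<Rightarrow> real" where
  "total_quantity P q = (\<Sum>i=1..n_demand P. \<Sum>j=1..n_supply P. q i j)"

text \<open>
  Lining up the types by descending quality, type \<open>i\<close> occupies the \<open>i\<close>-th segment of the line.
  In a top-down matching of total quantity \<open>Q\<close>, the unit at position \<open>z \<le> Q\<close> of the demand line is
  matched with the unit at the same position of the supply line, so \<open>q i j\<close> is the length of the
  set of those positions that carry demand type \<open>i\<close> and supply type \<open>j\<close>.
\<close>

definition line_segment :: "(nat \<Rightarrow> real) \<Rightarrow> nat \<Rightarrow> real set" where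
  "line_segment x i = {cum x (i - 1)<..cum x i}"

definition top_down_matching ::
    "'w matching_model \<Rightarrow> (nat \<Rightarrow> real) \<Rightarrow> (nat \<Rightarrow> real) \<Rightarrow> (nat \<Rightarrow> nat \<Rightarrow> real) \<Rightarrow> bool" where
  "top_down_matching P x y q \<longleftrightarrow>
     (\<forall>i\<in>{1..n_demand P}. \<forall>j\<in>{1..n_supply P}.
        q i j = measure lborel
          (line_segment x i \<inter> line_segment y j \<inter> {0<..total_quantity P q}))"

end

theory Submission
  imports Defs
begin

text \<open>
  Fix the total quantity matched in a period. Vertical rewards are separable, so only the numbers of
  units used of each type matter, and the question is which units to use now and which to keep. Using
  a unit of demand type \<open>i\<close> instead of a unit of the worse type \<open>i + 1\<close> gains \<open>rd t i - rd t (i + 1)\<close>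
  now. It leaves a worse unit for the next period, of which only the fraction
  \<open>carry_demand P\<close> survives; if replacing a unit of type \<open>i + 1\<close> by one of type \<open>i\<close> raises the next
  value function by at most \<open>rd (t + 1) i - rd (t + 1) (i + 1)\<close>, the assumption on the discounted
  quality gaps says that the loss does not exceed the gain. Hence the best units should be used first.

  The bound on the value of an upgrade is the property \<open>upgrade_bounded\<close>, stated for whole vectors:
  \<open>dominates\<close> says that one vector arises from another by upgrading units, that is, that its partial
  sums are at least as large and its total is the same. It has to be propagated backwards in time. Both
  the optimality of top-down matching in a period and the propagation through the maximization are
  instances of one exchange argument, \<open>stage_value_le_top_down\<close>, which compares an arbitrary decision
  for a better state with the top-down matching of the same quantity for a worse state: the latter
  uses the best units, so its leftovers are dominated. The propagation through the expectation,
  \<open>upgrade_bounded_continuation\<close>, applies the bound for every outcome and then sums by parts.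

  The maximum must also be shown to exist, and the expectations to be those of integrable functions.
  For this the induction carries a Lipschitz bound in the \<open>l\<^sup>1\<close> distance of the states. Once only
  top-down matchings matter, a decision is a single number, the quantity, and the matching is an
  explicit Lipschitz function of this number and the state; so the maximum is attained
  (\<open>ex_optimal_top_down\<close>) and the value function is again Lipschitz (\<open>lipschitz_stage_sup\<close>).
\<close>

section \<open>Vectors and domination\<close>

lemma cum_0 [simp]: "cum x 0 = 0"
  by (simp add: cum_def)

lemma cum_Suc [simp]: "cum x (Suc i) = cum x i + x (Suc i)"
  by (simp add: cum_def)

lemma cum_diff: "cum (\<lambda>i. x i - w i) k = cum x k - cum w k"
  by (simp add: cum_def sum_subtractf)

lemma nonneg_vecs_nonneg: "x \<in> nonneg_vecs k \<Longrightarrow> 0 \<le> x i"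
  by (cases "i \<in> {1..k}") (auto simp: nonneg_vecs_def)

lemma nonneg_vecsI:
  assumes "\<And>i. i \<in> {1..k} \<Longrightarrow> 0 \<le> x i" and "\<And>i. i \<notin> {1..k} \<Longrightarrow> x i = 0"
  shows "x \<in> nonneg_vecs k"
  using assms by (auto simp: nonneg_vecs_def)

lemma cum_mono:
  assumes "x \<in> nonneg_vecs k" and "i \<le> j"
  shows "cum x i \<le> cum x j"
  unfolding cum_def using assms by (intro sum_mono2) (auto simp: nonneg_vecs_nonneg)

lemma cum_nonneg: "x \<in> nonneg_vecs k \<Longrightarrow> 0 \<le> cum x i"
  using cum_mono[of x k 0 i] by simp

definition vec_dist :: "nat \<Rightarrow> (nat \<Rightarrow> real) \<Rightarrow> (nat \<Rightarrow> real) \<Rightarrow> real" where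
  "vec_dist k x x' = (\<Sum>i=1..k. \<bar>x i - x' i\<bar>)"

lemma vec_dist_nonneg: "0 \<le> vec_dist k x x'"
  by (simp add: vec_dist_def sum_nonneg)

lemma vec_dist_sym: "vec_dist k x x' = vec_dist k x' x"
  by (simp add: vec_dist_def abs_minus_commute)

lemma vec_dist_self [simp]: "vec_dist k x x = 0"
  by (simp add: vec_dist_def)

lemma cum_vec_dist:
  assumes "i \<le> k"
  shows "\<bar>cum x i - cum x' i\<bar> \<le> vec_dist k x x'"
proof -
  have "\<bar>cum x i - cum x' i\<bar> \<le> (\<Sum>l=1..i. \<bar>x l - x' l\<bar>)"
    unfolding cum_def sum_subtractf[symmetric] by (rule sum_abs)
  also have "\<dots> \<le> vec_dist k x x'"
    unfolding vec_dist_def using assms by (intro sum_mono2) auto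
  finally show ?thesis .
qed

text \<open>
  The vector \<open>x'\<close> arises from \<open>x\<close> by upgrading some units to better types, the number of units
  being kept.
\<close>

definition dominates :: "nat \<Rightarrow> (nat \<Rightarrow> real) \<Rightarrow> (nat \<Rightarrow> real) \<Rightarrow> bool" where
  "dominates k x' x \<longleftrightarrow> (\<forall>i\<le>k. cum x i \<le> cum x' i) \<and> cum x k = cum x' k"

lemma dominates_refl: "dominates k x x"
  by (simp add: dominates_def)

text \<open>
  Summation by parts: the sum is a combination of the partial sums of \<open>x' - x\<close> with the decrements
  of \<open>c\<close> as weights. The last weight is \<open>c k\<close>, whose sign is unknown, but it multiplies the
  difference of the totals, which is zero.
\<close>

lemma dominates_weighted_sum:
  assumes "dominates k x' x" and "\<And>i. i \<in> {1..<k} \<Longrightarrow> c (i + 1) \<le> c i"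
  shows "0 \<le> (\<Sum>i=1..k. c i * (x' i - x i))"
proof -
  define d where "d = (\<lambda>i. x' i - x i)"
  have parts: "c i * cum d i \<le> (\<Sum>l=1..i. c l * d l)" if "i \<le> k" for i
    using that
  proof (induction i)
    case (Suc i)
    have "0 \<le> cum d i"
      using assms(1) Suc.prems by (simp add: d_def cum_diff dominates_def)
    then have "c (Suc i) * cum d i \<le> c i * cum d i"
      using assms(2)[of i] Suc.prems by (cases "i = 0") (auto intro: mult_right_mono)
    then show ?case
      using Suc by (simp add: algebra_simps)
  qed simp
  have "cum d k = 0"
    using assms(1) by (simp add: d_def cum_diff dominates_def)
  then show ?thesis
    using parts[of k] by (simp add: d_def)
qed

section \<open>The top-down matching of a given quantity\<close>

definition top_down :: "nat \<Rightarrow> nat \<Rightarrow> (nat \<Rightarrow> real) \<Rightarrow> (nat \<Rightarrow> real) \<Rightarrow> real \<Rightarrow> nat \<Rightarrow> nat \<Rightarrow> real" where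
  "top_down m n x y Q i j =
     (if i \<in> {1..m} \<and> j \<in> {1..n}
      then max 0 (min (min (cum x i) (cum y j)) Q - max (cum x (i - 1)) (cum y (j - 1)))
      else 0)"

lemma top_down_swap: "top_down m n x y Q i j = top_down n m y x Q j i"
  by (simp add: top_down_def min.commute max.commute)

text \<open>
  The number \<open>min (min a b) Q\<close> is the length of the part of the first \<open>Q\<close> positions that lies below
  \<open>a\<close> on the demand line and below \<open>b\<close> on the supply line. The length for a pair of segments is the
  mixed difference of this function, so that sums over segments telescope.
\<close>

lemma overlap_as_mixed_difference:
  fixes a a' b b' Q :: real
  assumes "a' \<le> a" and "b' \<le> b"
  shows "max 0 (min (min a b) Q - max a' b') =
         (min (min a b) Q - min (min a' b) Q) - (min (min a b') Q - min (min a' b') Q)"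
  using assms by (auto simp: min_def max_def)

lemma top_down_row_sum:
  assumes "x \<in> nonneg_vecs m" and "y \<in> nonneg_vecs n" and "0 \<le> Q" and "i \<in> {1..m}"
  shows "(\<Sum>j=1..n. top_down m n x y Q i j) =
         min (min (cum x i) (cum y n)) Q - min (min (cum x (i - 1)) (cum y n)) Q"
proof -
  define F where "F = (\<lambda>j. min (min (cum x i) (cum y j)) Q - min (min (cum x (i - 1)) (cum y j)) Q)"
  have "top_down m n x y Q i j = F j - F (j - 1)" if "j \<in> {1..n}" for j
    unfolding top_down_def F_def using that assms(4)
    by (simp only: simp_thms if_True overlap_as_mixed_difference[OF cum_mono[OF assms(1) diff_le_self]
          cum_mono[OF assms(2) diff_le_self]])
  then have "(\<Sum>j=1..n. top_down m n x y Q i j) = (\<Sum>j=1..n. F j - F (j - 1))"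
    by simp
  also have "\<dots> = F n - F 0"
    using sum_telescope''[of 0 n F] by (simp add: atLeastSucAtMost_greaterThanAtMost)
  also have "F 0 = 0"
    using cum_nonneg[OF assms(1)] assms(3) by (simp add: F_def)
  finally show ?thesis
    by (simp add: F_def)
qed

lemma top_down_row_cum:
  assumes "x \<in> nonneg_vecs m" and "y \<in> nonneg_vecs n" and "0 \<le> Q" and "i \<le> m"
  shows "cum (\<lambda>i. \<Sum>j=1..n. top_down m n x y Q i j) i = min (min (cum x i) (cum y n)) Q"
  using assms(4)
proof (induction i)
  case 0
  then show ?case
    using cum_nonneg[OF assms(2)] assms(3) by simp
next
  case (Suc i)
  then show ?case
    using top_down_row_sum[OF assms(1-3), of "Suc i"] by simp
qed

lemma top_down_row_le:
  assumes "x \<in> nonneg_vecs m" and "y \<in> nonneg_vecs n" and "0 \<le> Q" and "i \<in> {1..m}"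
  shows "(\<Sum>j=1..n. top_down m n x y Q i j) \<le> x i"
proof -
  have "cum x i = cum x (i - 1) + x i"
    using assms(4) by (cases i) auto
  moreover have "min (min (a + d) b) Q - min (min a b) Q \<le> d" if "0 \<le> d" for a b d :: real
    using that by linarith
  ultimately show ?thesis
    unfolding top_down_row_sum[OF assms] using nonneg_vecs_nonneg[OF assms(1), of i] by metis
qed

lemma top_down_feasible:
  assumes "x \<in> nonneg_vecs (n_demand P)" and "y \<in> nonneg_vecs (n_supply P)" and "0 \<le> Q"
  shows "top_down (n_demand P) (n_supply P) x y Q \<in> feasible P x y"
proof -
  have "0 \<le> left_supply P y (top_down (n_demand P) (n_supply P) x y Q) j"
    if "j \<in> {1..n_supply P}" for j
    using top_down_row_le[OF assms(2,1,3) that]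
    by (simp add: left_supply_def top_down_swap[of "n_demand P"])
  moreover have "0 \<le> left_demand P x (top_down (n_demand P) (n_supply P) x y Q) i"
    if "i \<in> {1..n_demand P}" for i
    using top_down_row_le[OF assms that] by (simp add: left_demand_def)
  ultimately show ?thesis
    by (auto simp: feasible_def nonneg_mats_def top_down_def)
qed

lemma total_quantity_top_down:
  assumes "x \<in> nonneg_vecs (n_demand P)" and "y \<in> nonneg_vecs (n_supply P)" and "0 \<le> Q"
  shows "total_quantity P (top_down (n_demand P) (n_supply P) x y Q) =
         min (min (cum x (n_demand P)) (cum y (n_supply P))) Q"
  using top_down_row_cum[OF assms order.refl] by (simp add: total_quantity_def cum_def)

text \<open>
  A quantity larger than one of the lines is cut off by the formula itself, hence the parameter
  \<open>Q\<close> may be replaced by the total quantity.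
\<close>

lemma top_down_formula:
  assumes "x \<in> nonneg_vecs (n_demand P)" and "y \<in> nonneg_vecs (n_supply P)" and "0 \<le> Q"
    and "i \<in> {1..n_demand P}" and "j \<in> {1..n_supply P}"
    and q: "q = top_down (n_demand P) (n_supply P) x y Q"
  shows "q i j = max 0 (min (min (cum x i) (cum y j)) (total_quantity P q)
                        - max (cum x (i - 1)) (cum y (j - 1)))"
proof -
  have "cum x i \<le> cum x (n_demand P)" "cum y j \<le> cum y (n_supply P)"
    using assms(4,5) by (auto intro: cum_mono[OF assms(1)] cum_mono[OF assms(2)])
  then have "min (min (cum x i) (cum y j)) (total_quantity P q) = min (min (cum x i) (cum y j)) Q"
    unfolding q total_quantity_top_down[OF assms(1-3)] by linarith
  then show ?thesis
    using assms(4,5) unfolding q by (simp add: top_down_def)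
qed

lemma top_down_matching_top_down:
  assumes "x \<in> nonneg_vecs (n_demand P)" and "y \<in> nonneg_vecs (n_supply P)" and "0 \<le> Q"
  shows "top_down_matching P x y (top_down (n_demand P) (n_supply P) x y Q)"
proof -
  define q where "q = top_down (n_demand P) (n_supply P) x y Q"
  have "q i j = measure lborel (line_segment x i \<inter> line_segment y j \<inter> {0<..total_quantity P q})"
    if ij: "i \<in> {1..n_demand P}" "j \<in> {1..n_supply P}" for i j
  proof -
    have "0 \<le> cum x (i - 1)" "0 \<le> cum y (j - 1)"
      using cum_nonneg[OF assms(1)] cum_nonneg[OF assms(2)] by auto
    then have "line_segment x i \<inter> line_segment y j \<inter> {0<..total_quantity P q} =
       {max (cum x (i - 1)) (cum y (j - 1))<..min (min (cum x i) (cum y j)) (total_quantity P q)}"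
      by (auto simp: line_segment_def)
    moreover have "measure lborel {a<..b} = max 0 (b - a)" for a b :: real
      by (cases "a \<le> b") auto
    ultimately show ?thesis
      unfolding top_down_formula[OF assms ij q_def] by simp
  qed
  then show ?thesis
    by (simp add: top_down_matching_def q_def)
qed

lemma min_max_lipschitz:
  fixes a a' b b' e :: real
  assumes "\<bar>a - a'\<bar> \<le> e" and "\<bar>b - b'\<bar> \<le> e"
  shows "\<bar>min a b - min a' b'\<bar> \<le> e" and "\<bar>max a b - max a' b'\<bar> \<le> e"
  using assms by linarith+

lemma top_down_lipschitz:
  "\<bar>top_down m n x y Q i j - top_down m n x' y' Q' i j\<bar>
     \<le> 2 * (vec_dist m x x' + vec_dist n y y' + \<bar>Q - Q'\<bar>)"
proof (cases "i \<in> {1..m} \<and> j \<in> {1..n}")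
  case True
  define e where "e = vec_dist m x x' + vec_dist n y y' + \<bar>Q - Q'\<bar>"
  have x: "\<bar>cum x i - cum x' i\<bar> \<le> e" if "i \<le> m" for i
    using cum_vec_dist[OF that, of x x'] vec_dist_nonneg[of n y y'] unfolding e_def by linarith
  have y: "\<bar>cum y j - cum y' j\<bar> \<le> e" if "j \<le> n" for j
    using cum_vec_dist[OF that, of y y'] vec_dist_nonneg[of m x x'] unfolding e_def by linarith
  have Q: "\<bar>Q - Q'\<bar> \<le> e"
    using vec_dist_nonneg[of m x x'] vec_dist_nonneg[of n y y'] unfolding e_def by linarith
  have ij: "i \<le> m" "i - 1 \<le> m" "j \<le> n" "j - 1 \<le> n"
    using True by auto
  have "\<bar>min (min (cum x i) (cum y j)) Q - min (min (cum x' i) (cum y' j)) Q'\<bar> \<le> e"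
    by (intro min_max_lipschitz x y Q ij)
  moreover have "\<bar>max (cum x (i - 1)) (cum y (j - 1)) - max (cum x' (i - 1)) (cum y' (j - 1))\<bar> \<le> e"
    by (intro min_max_lipschitz x y ij)
  moreover have "\<bar>max 0 (p - r) - max 0 (p' - r')\<bar> \<le> 2 * e"
    if "\<bar>p - p'\<bar> \<le> e" "\<bar>r - r'\<bar> \<le> e" for p p' r r' :: real
    using that by linarith
  ultimately have "\<bar>max 0 (min (min (cum x i) (cum y j)) Q - max (cum x (i - 1)) (cum y (j - 1))) -
      max 0 (min (min (cum x' i) (cum y' j)) Q' - max (cum x' (i - 1)) (cum y' (j - 1)))\<bar> \<le> 2 * e"
    by blast
  then show ?thesis
    unfolding top_down_def e_def using True by (simp only: simp_thms if_True)
next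
  case False
  then show ?thesis
    unfolding top_down_def using vec_dist_nonneg[of m x x'] vec_dist_nonneg[of n y y'] by auto
qed

section \<open>One period with a given continuation value\<close>

definition lipschitz_states ::
    "nat \<Rightarrow> nat \<Rightarrow> ((nat \<Rightarrow> real) \<Rightarrow> (nat \<Rightarrow> real) \<Rightarrow> real) \<Rightarrow> real \<Rightarrow> bool" where
  "lipschitz_states m n G L \<longleftrightarrow> 0 \<le> L \<and>
     (\<forall>x\<in>nonneg_vecs m. \<forall>x'\<in>nonneg_vecs m. \<forall>y\<in>nonneg_vecs n. \<forall>y'\<in>nonneg_vecs n.
        \<bar>G x y - G x' y'\<bar> \<le> L * (vec_dist m x x' + vec_dist n y y'))"

text \<open>
  Upgrading units raises the value \<open>G\<close> by at most the difference of the unit rewards \<open>c\<close> and \<open>s\<close>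
  that these units would earn if they were matched now.
\<close>

definition upgrade_bounded ::
    "nat \<Rightarrow> nat \<Rightarrow> (nat \<Rightarrow> real) \<Rightarrow> (nat \<Rightarrow> real) \<Rightarrow> ((nat \<Rightarrow> real) \<Rightarrow> (nat \<Rightarrow> real) \<Rightarrow> real) \<Rightarrow> bool" where
  "upgrade_bounded m n c s G \<longleftrightarrow>
     (\<forall>x\<in>nonneg_vecs m. \<forall>x'\<in>nonneg_vecs m. \<forall>y\<in>nonneg_vecs n. \<forall>y'\<in>nonneg_vecs n.
        dominates m x' x \<longrightarrow> dominates n y' y \<longrightarrow>
        G x' y' \<le> G x y + (\<Sum>i=1..m. c i * (x' i - x i)) + (\<Sum>j=1..n. s j * (y' j - y j)))"

text \<open>
  The objective of one period, with the expected future value as an arbitrary function \<open>G\<close> of the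
  unmatched quantities: the maximization over decisions uses only the two properties above of \<open>G\<close>,
  so it can be treated apart from the expectation.
\<close>

definition stage_value ::
    "'w matching_model \<Rightarrow> (nat \<Rightarrow> real) \<Rightarrow> (nat \<Rightarrow> real) \<Rightarrow> ((nat \<Rightarrow> real) \<Rightarrow> (nat \<Rightarrow> real) \<Rightarrow> real) \<Rightarrow>
     (nat \<Rightarrow> real) \<Rightarrow> (nat \<Rightarrow> real) \<Rightarrow> (nat \<Rightarrow> nat \<Rightarrow> real) \<Rightarrow> real" where
  "stage_value P c s G x y q =
     (\<Sum>i=1..n_demand P. \<Sum>j=1..n_supply P. (c i + s j) * q i j) +
     G (left_demand P x q) (left_supply P y q)"

lemma left_demand_nonneg_vecs:
  assumes "x \<in> nonneg_vecs (n_demand P)" and "q \<in> feasible P x y"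
  shows "left_demand P x q \<in> nonneg_vecs (n_demand P)"
  using assms by (intro nonneg_vecsI) (auto simp: feasible_def nonneg_mats_def nonneg_vecs_def left_demand_def)

lemma left_supply_nonneg_vecs:
  assumes "y \<in> nonneg_vecs (n_supply P)" and "q \<in> feasible P x y"
  shows "left_supply P y q \<in> nonneg_vecs (n_supply P)"
  using assms by (intro nonneg_vecsI) (auto simp: feasible_def nonneg_mats_def nonneg_vecs_def left_supply_def)

text \<open>
  In this form the rewards of the used units and the reward differences of the leftovers in
  \<open>upgrade_bounded\<close> add up to reward differences of the state vectors.
\<close>

lemma separable_reward_via_leftovers:
  "(\<Sum>i=1..n_demand P. \<Sum>j=1..n_supply P. (c i + s j) * q i j) =
     (\<Sum>i=1..n_demand P. c i * (x i - left_demand P x q i)) +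
     (\<Sum>j=1..n_supply P. s j * (y j - left_supply P y q j))"
proof -
  have "(\<Sum>i=1..n_demand P. \<Sum>j=1..n_supply P. s j * q i j) =
        (\<Sum>j=1..n_supply P. \<Sum>i=1..n_demand P. s j * q i j)"
    by (rule sum.swap)
  then show ?thesis
    by (simp add: left_demand_def left_supply_def distrib_right sum.distrib sum_distrib_left)
qed

text \<open>
  Serving \<open>Q\<close> units from the top of the line of \<open>x\<close> leaves the worst leftovers possible: of the first
  \<open>i\<close> types, \<open>max 0 (cum x i - Q)\<close> units remain, and no consumption \<open>w\<close> of \<open>Q\<close> units from a better
  vector \<open>x'\<close> can leave less of them.
\<close>

lemma dominates_top_down_leftover:
  assumes x: "x \<in> nonneg_vecs m" and y: "y \<in> nonneg_vecs n"
    and w: "\<And>i. 0 \<le> w i" "\<And>i. i \<in> {1..m} \<Longrightarrow> w i \<le> x' i"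
    and dom: "dominates m x' x" and Q: "Q = cum w m" "Q \<le> cum y n"
  shows "dominates m (\<lambda>i. x' i - w i) (\<lambda>i. x i - (\<Sum>j=1..n. top_down m n x y Q i j))"
proof -
  have "0 \<le> Q"
    unfolding Q(1) cum_def using w(1) by (simp add: sum_nonneg)
  have w_le: "cum w i \<le> cum x' i" if "i \<le> m" for i
    unfolding cum_def using that w(2) by (intro sum_mono) auto
  have w_le_Q: "cum w i \<le> Q" if "i \<le> m" for i
    unfolding Q(1) cum_def using that w(1) by (intro sum_mono2) auto
  have td: "cum (\<lambda>i. \<Sum>j=1..n. top_down m n x y Q i j) i = min (cum x i) Q" if "i \<le> m" for i
    using top_down_row_cum[OF x y \<open>0 \<le> Q\<close> that] Q(2) by linarith
  have "Q \<le> cum x m"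
    using w_le[of m] dom Q(1) by (simp add: dominates_def)
  show ?thesis
    unfolding dominates_def cum_diff
  proof (intro conjI allI impI)
    fix i assume "i \<le> m"
    then show "cum x i - cum (\<lambda>i. \<Sum>j=1..n. top_down m n x y Q i j) i \<le> cum x' i - cum w i"
      using td[of i] w_le[of i] w_le_Q[of i] dom by (auto simp: dominates_def min_def)
  next
    show "cum x m - cum (\<lambda>i. \<Sum>j=1..n. top_down m n x y Q i j) m = cum x' m - cum w m"
      using td[of m] \<open>Q \<le> cum x m\<close> Q(1) dom by (simp add: dominates_def)
  qed
qed

lemma feasible_total_quantity:
  assumes "q \<in> feasible P x y"
  shows "0 \<le> total_quantity P q" and "total_quantity P q \<le> cum x (n_demand P)"
    and "total_quantity P q \<le> cum y (n_supply P)"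
    and "total_quantity P q = cum (\<lambda>i. \<Sum>j=1..n_supply P. q i j) (n_demand P)"
    and "total_quantity P q = cum (\<lambda>j. \<Sum>i=1..n_demand P. q i j) (n_supply P)"
proof -
  show rows: "total_quantity P q = cum (\<lambda>i. \<Sum>j=1..n_supply P. q i j) (n_demand P)"
    by (simp add: total_quantity_def cum_def)
  show cols: "total_quantity P q = cum (\<lambda>j. \<Sum>i=1..n_demand P. q i j) (n_supply P)"
    unfolding total_quantity_def cum_def by (rule sum.swap)
  show "0 \<le> total_quantity P q"
    unfolding total_quantity_def using assms
    by (intro sum_nonneg) (auto simp: feasible_def nonneg_mats_def)
  show "total_quantity P q \<le> cum x (n_demand P)"
    unfolding rows cum_def using assms by (intro sum_mono) (auto simp: feasible_def left_demand_def)
  show "total_quantity P q \<le> cum y (n_supply P)"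
    unfolding cols cum_def using assms by (intro sum_mono) (auto simp: feasible_def left_supply_def)
qed

lemma feasible_nonneg: "q \<in> feasible P x y \<Longrightarrow> 0 \<le> q i j"
  by (cases "i \<in> {1..n_demand P} \<and> j \<in> {1..n_supply P}") (auto simp: feasible_def nonneg_mats_def)

text \<open>
  The exchange argument. Both decisions serve the same quantity. Since the leftovers of \<open>q\<close> dominate
  those of the top-down matching, \<open>upgrade_bounded\<close> lets them gain at most their reward difference in
  the continuation; adding the rewards of the matched units leaves the reward difference of the full
  state vectors. For equal states this is the optimality of top-down matching; for different ones it
  is the property \<open>upgrade_bounded\<close> of the value of this period.
\<close>

lemma stage_value_le_top_down:
  assumes x: "x \<in> nonneg_vecs (n_demand P)" and y: "y \<in> nonneg_vecs (n_supply P)"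
    and x': "x' \<in> nonneg_vecs (n_demand P)" and y': "y' \<in> nonneg_vecs (n_supply P)"
    and domx: "dominates (n_demand P) x' x" and domy: "dominates (n_supply P) y' y"
    and q: "q \<in> feasible P x' y'"
    and G: "upgrade_bounded (n_demand P) (n_supply P) c s G"
  shows "stage_value P c s G x' y' q \<le>
     stage_value P c s G x y (top_down (n_demand P) (n_supply P) x y (total_quantity P q)) +
     (\<Sum>i=1..n_demand P. c i * (x' i - x i)) + (\<Sum>j=1..n_supply P. s j * (y' j - y j))"
proof -
  define m n where "m = n_demand P" and "n = n_supply P"
  define Q where "Q = total_quantity P q"
  define p where "p = top_down m n x y Q"
  note Qs = feasible_total_quantity[OF q, folded m_def n_def Q_def]
  have Qx: "Q \<le> cum x m" and Qy: "Q \<le> cum y n"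
    using Qs domx domy by (simp_all add: dominates_def m_def n_def)
  have p: "p \<in> feasible P x y"
    unfolding p_def m_def n_def by (rule top_down_feasible[OF x y Qs(1)])
  have dem: "dominates m (left_demand P x' q) (left_demand P x p)"
    unfolding left_demand_def p_def n_def[symmetric]
  proof (rule dominates_top_down_leftover)
    show "(\<Sum>j=1..n. q i j) \<le> x' i" if "i \<in> {1..m}" for i
      using q that by (simp add: feasible_def left_demand_def m_def n_def)
  qed (use x y domx Qs(4) Qy feasible_nonneg[OF q] in \<open>auto simp: m_def n_def intro!: sum_nonneg\<close>)
  have sup: "dominates n (left_supply P y' q) (left_supply P y p)"
    unfolding left_supply_def p_def m_def[symmetric] top_down_swap[of m n]
  proof (rule dominates_top_down_leftover)
    show "(\<Sum>i=1..m. q i j) \<le> y' j" if "j \<in> {1..n}" for j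
      using q that by (simp add: feasible_def left_supply_def m_def n_def)
  qed (use x y domy Qs(5) Qx feasible_nonneg[OF q] in \<open>auto simp: m_def n_def intro!: sum_nonneg\<close>)
  have "G (left_demand P x' q) (left_supply P y' q) \<le> G (left_demand P x p) (left_supply P y p) +
      (\<Sum>i=1..m. c i * (left_demand P x' q i - left_demand P x p i)) +
      (\<Sum>j=1..n. s j * (left_supply P y' q j - left_supply P y p j))"
    using G dem sup x y x' y' left_demand_nonneg_vecs[OF x p] left_demand_nonneg_vecs[OF x' q]
      left_supply_nonneg_vecs[OF y p] left_supply_nonneg_vecs[OF y' q]
    unfolding upgrade_bounded_def m_def n_def by blast
  then show ?thesis
    using separable_reward_via_leftovers[of c s q P x' y'] separable_reward_via_leftovers[of c s p P x y]
    unfolding stage_value_def m_def[symmetric] n_def[symmetric] Q_def[symmetric] p_def[symmetric]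
    by (simp add: right_diff_distrib sum_subtractf)
qed

lemma sum_abs_diff_le:
  fixes f g :: "nat \<Rightarrow> real"
  assumes "\<And>j. \<bar>f j - g j\<bar> \<le> e"
  shows "\<bar>sum f {1..n} - sum g {1..n}\<bar> \<le> real n * e"
proof -
  have "\<bar>sum f {1..n} - sum g {1..n}\<bar> \<le> (\<Sum>j=1..n. \<bar>f j - g j\<bar>)"
    unfolding sum_subtractf[symmetric] by (rule sum_abs)
  also have "\<dots> \<le> real n * e"
    using sum_bounded_above[of "{1..n}" "\<lambda>j. \<bar>f j - g j\<bar>" e] assms by simp
  finally show ?thesis .
qed

lemma vec_dist_leftover:
  assumes "\<And>i j. \<bar>q i j - q' i j\<bar> \<le> e"
  shows "vec_dist m (\<lambda>i. x i - (\<Sum>j=1..n. q i j)) (\<lambda>i. x' i - (\<Sum>j=1..n. q' i j))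
     \<le> vec_dist m x x' + real m * real n * e"
proof -
  have "\<bar>(x i - (\<Sum>j=1..n. q i j)) - (x' i - (\<Sum>j=1..n. q' i j))\<bar> \<le> \<bar>x i - x' i\<bar> + real n * e" for i
    using sum_abs_diff_le[of "q i" "q' i" e n] assms by fastforce
  then have "vec_dist m (\<lambda>i. x i - (\<Sum>j=1..n. q i j)) (\<lambda>i. x' i - (\<Sum>j=1..n. q' i j))
      \<le> (\<Sum>i=1..m. \<bar>x i - x' i\<bar> + real n * e)"
    unfolding vec_dist_def by (intro sum_mono)
  then show ?thesis
    by (simp add: vec_dist_def sum.distrib mult.assoc)
qed

lemma stage_value_lipschitz:
  assumes x: "x \<in> nonneg_vecs (n_demand P)" and y: "y \<in> nonneg_vecs (n_supply P)"
    and x': "x' \<in> nonneg_vecs (n_demand P)" and y': "y' \<in> nonneg_vecs (n_supply P)"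
    and q: "q \<in> feasible P x y" and q': "q' \<in> feasible P x' y'"
    and e: "\<And>i j. \<bar>q i j - q' i j\<bar> \<le> e"
    and G: "lipschitz_states (n_demand P) (n_supply P) G L"
  shows "\<bar>stage_value P c s G x y q - stage_value P c s G x' y' q'\<bar> \<le>
     (\<Sum>i=1..n_demand P. \<Sum>j=1..n_supply P. \<bar>c i + s j\<bar>) * e +
     L * (vec_dist (n_demand P) x x' + vec_dist (n_supply P) y y' +
          2 * real (n_demand P) * real (n_supply P) * e)"
proof -
  define m n where "m = n_demand P" and "n = n_supply P"
  have "\<bar>(\<Sum>i=1..m. \<Sum>j=1..n. (c i + s j) * q i j) - (\<Sum>i=1..m. \<Sum>j=1..n. (c i + s j) * q' i j)\<bar>
      = \<bar>\<Sum>i=1..m. \<Sum>j=1..n. (c i + s j) * (q i j - q' i j)\<bar>"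
    by (simp add: right_diff_distrib sum_subtractf)
  also have "\<dots> \<le> (\<Sum>i=1..m. \<Sum>j=1..n. \<bar>(c i + s j) * (q i j - q' i j)\<bar>)"
    by (rule order.trans[OF sum_abs], rule sum_mono, rule sum_abs)
  also have "\<dots> \<le> (\<Sum>i=1..m. \<Sum>j=1..n. \<bar>c i + s j\<bar> * e)"
    unfolding abs_mult by (intro sum_mono mult_left_mono e) auto
  also have "\<dots> = (\<Sum>i=1..m. \<Sum>j=1..n. \<bar>c i + s j\<bar>) * e"
    by (simp add: sum_distrib_right)
  finally have 1: "\<bar>(\<Sum>i=1..m. \<Sum>j=1..n. (c i + s j) * q i j) - (\<Sum>i=1..m. \<Sum>j=1..n. (c i + s j) * q' i j)\<bar>
      \<le> (\<Sum>i=1..m. \<Sum>j=1..n. \<bar>c i + s j\<bar>) * e" .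
  have "0 \<le> L"
    using G by (simp add: lipschitz_states_def)
  have "\<bar>G (left_demand P x q) (left_supply P y q) - G (left_demand P x' q') (left_supply P y' q')\<bar>
      \<le> L * (vec_dist m (left_demand P x q) (left_demand P x' q') +
             vec_dist n (left_supply P y q) (left_supply P y' q'))"
    using G left_demand_nonneg_vecs[OF x q] left_demand_nonneg_vecs[OF x' q']
      left_supply_nonneg_vecs[OF y q] left_supply_nonneg_vecs[OF y' q']
    unfolding lipschitz_states_def m_def n_def by blast
  also have "\<dots> \<le> L * ((vec_dist m x x' + real m * real n * e) + (vec_dist n y y' + real n * real m * e))"
    using vec_dist_leftover[of q q' e m x n x', OF e]
      vec_dist_leftover[of "\<lambda>j i. q i j" "\<lambda>j i. q' i j" e n y m y', OF e] \<open>0 \<le> L\<close>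
    unfolding left_demand_def left_supply_def m_def n_def
    by (intro mult_left_mono add_mono) auto
  finally have 2: "\<bar>G (left_demand P x q) (left_supply P y q) - G (left_demand P x' q') (left_supply P y' q')\<bar>
      \<le> L * (vec_dist m x x' + vec_dist n y y' + 2 * real m * real n * e)"
    by (simp add: algebra_simps)
  show ?thesis
    using 1 2 unfolding stage_value_def m_def n_def by linarith
qed

text \<open>
  By the exchange argument it suffices to choose the quantity, and the value of the top-down matching
  is a continuous function of the quantity on a compact interval.
\<close>

lemma ex_optimal_top_down:
  assumes x: "x \<in> nonneg_vecs (n_demand P)" and y: "y \<in> nonneg_vecs (n_supply P)"
    and G: "upgrade_bounded (n_demand P) (n_supply P) c s G"
    and L: "lipschitz_states (n_demand P) (n_supply P) G L"
  shows "\<exists>Q\<ge>0. \<forall>q\<in>feasible P x y. stage_value P c s G x y q \<le>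
           stage_value P c s G x y (top_down (n_demand P) (n_supply P) x y Q)"
proof -
  define m n where "m = n_demand P" and "n = n_supply P"
  define g where "g = (\<lambda>Q. stage_value P c s G x y (top_down m n x y Q))"
  define K where "K = (\<Sum>i=1..m. \<Sum>j=1..n. \<bar>c i + s j\<bar>) * 2 + L * (2 * real m * real n * 2)"
  have "K-lipschitz_on {0..cum x m} g"
  proof (rule lipschitz_onI)
    fix Q Q' :: real assume Q: "Q \<in> {0..cum x m}" "Q' \<in> {0..cum x m}"
    then have f: "top_down m n x y Q \<in> feasible P x y" "top_down m n x y Q' \<in> feasible P x y"
      using x y unfolding m_def n_def by (auto intro: top_down_feasible)
    have "\<bar>top_down m n x y Q i j - top_down m n x y Q' i j\<bar> \<le> 2 * \<bar>Q - Q'\<bar>" for i j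
      using top_down_lipschitz[of m n x y Q i j x y Q'] by simp
    from stage_value_lipschitz[OF x y x y f this L]
    show "dist (g Q) (g Q') \<le> K * dist Q Q'"
      unfolding g_def dist_real_def K_def m_def n_def by (simp add: algebra_simps)
  next
    show "0 \<le> K"
      unfolding K_def using L
      by (intro add_nonneg_nonneg mult_nonneg_nonneg sum_nonneg) (auto simp: lipschitz_states_def)
  qed
  then have "continuous_on {0..cum x m} g"
    by (rule lipschitz_on_continuous_on)
  then obtain Q where Q: "Q \<in> {0..cum x m}" "\<forall>Q'\<in>{0..cum x m}. g Q' \<le> g Q"
    using continuous_attains_sup[of "{0..cum x m}" g] cum_nonneg[OF x, of m] by auto
  have "stage_value P c s G x y q \<le> g Q" if q: "q \<in> feasible P x y" for q
  proof -
    have "stage_value P c s G x y q \<le> g (total_quantity P q)"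
      using stage_value_le_top_down[OF x y x y dominates_refl dominates_refl q G]
      by (simp add: g_def m_def n_def)
    also have "\<dots> \<le> g Q"
      using Q(2) feasible_total_quantity(1,2)[OF q] by (simp add: m_def)
    finally show ?thesis .
  qed
  then show ?thesis
    using Q(1) unfolding g_def m_def n_def by auto
qed

definition stage_sup ::
    "'w matching_model \<Rightarrow> (nat \<Rightarrow> real) \<Rightarrow> (nat \<Rightarrow> real) \<Rightarrow> ((nat \<Rightarrow> real) \<Rightarrow> (nat \<Rightarrow> real) \<Rightarrow> real) \<Rightarrow>
     (nat \<Rightarrow> real) \<Rightarrow> (nat \<Rightarrow> real) \<Rightarrow> real" where
  "stage_sup P c s G x y = (SUP q\<in>feasible P x y. stage_value P c s G x y q)"

lemma stage_value_le_stage_sup: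
  assumes x: "x \<in> nonneg_vecs (n_demand P)" and y: "y \<in> nonneg_vecs (n_supply P)"
    and G: "upgrade_bounded (n_demand P) (n_supply P) c s G"
    and L: "lipschitz_states (n_demand P) (n_supply P) G L"
    and q: "q \<in> feasible P x y"
  shows "stage_value P c s G x y q \<le> stage_sup P c s G x y"
  unfolding stage_sup_def using q ex_optimal_top_down[OF x y G L]
  by (auto intro!: cSUP_upper bdd_aboveI2)

lemma stage_sup_leI:
  assumes x: "x \<in> nonneg_vecs (n_demand P)" and y: "y \<in> nonneg_vecs (n_supply P)"
    and "\<And>q. q \<in> feasible P x y \<Longrightarrow> stage_value P c s G x y q \<le> B"
  shows "stage_sup P c s G x y \<le> B"
  unfolding stage_sup_def using top_down_feasible[OF x y, of 0] assms(3)
  by (intro cSUP_least) auto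

lemma upgrade_bounded_stage_sup:
  assumes G: "upgrade_bounded (n_demand P) (n_supply P) c s G"
    and L: "lipschitz_states (n_demand P) (n_supply P) G L"
  shows "upgrade_bounded (n_demand P) (n_supply P) c s (stage_sup P c s G)"
  unfolding upgrade_bounded_def
proof (intro ballI impI)
  fix x x' y y'
  assume x: "x \<in> nonneg_vecs (n_demand P)" and y: "y \<in> nonneg_vecs (n_supply P)"
    and x': "x' \<in> nonneg_vecs (n_demand P)" and y': "y' \<in> nonneg_vecs (n_supply P)"
    and dom: "dominates (n_demand P) x' x" "dominates (n_supply P) y' y"
  show "stage_sup P c s G x' y' \<le> stage_sup P c s G x y +
      (\<Sum>i=1..n_demand P. c i * (x' i - x i)) + (\<Sum>j=1..n_supply P. s j * (y' j - y j))"
  proof (rule stage_sup_leI[OF x' y'])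
    fix q assume q: "q \<in> feasible P x' y'"
    show "stage_value P c s G x' y' q \<le> stage_sup P c s G x y +
      (\<Sum>i=1..n_demand P. c i * (x' i - x i)) + (\<Sum>j=1..n_supply P. s j * (y' j - y j))"
      using stage_value_le_top_down[OF x y x' y' dom q G]
        stage_value_le_stage_sup[OF x y G L top_down_feasible[OF x y feasible_total_quantity(1)[OF q]]]
      by linarith
  qed
qed

text \<open>
  Two states are compared through their top-down matchings of the same quantity, whose entries are
  explicit Lipschitz functions of the state.
\<close>

lemma lipschitz_stage_sup:
  assumes G: "upgrade_bounded (n_demand P) (n_supply P) c s G"
    and L: "lipschitz_states (n_demand P) (n_supply P) G L"
  shows "\<exists>K. lipschitz_states (n_demand P) (n_supply P) (stage_sup P c s G) K"
proof -
  define m n where "m = n_demand P" and "n = n_supply P"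
  define K where "K = (\<Sum>i=1..m. \<Sum>j=1..n. \<bar>c i + s j\<bar>) * 2 + L * (1 + 4 * real m * real n)"
  have K: "0 \<le> K"
    unfolding K_def using L
    by (intro add_nonneg_nonneg mult_nonneg_nonneg sum_nonneg) (auto simp: lipschitz_states_def)
  have le: "stage_sup P c s G x y \<le> stage_sup P c s G x' y' + K * (vec_dist m x x' + vec_dist n y y')"
    if x: "x \<in> nonneg_vecs m" and y: "y \<in> nonneg_vecs n"
      and x': "x' \<in> nonneg_vecs m" and y': "y' \<in> nonneg_vecs n" for x x' y y'
    using x y unfolding m_def n_def
  proof (rule stage_sup_leI, fold m_def n_def)
    note xy = x[unfolded m_def] y[unfolded n_def] and xy' = x'[unfolded m_def] y'[unfolded n_def]
    fix q assume q: "q \<in> feasible P x y"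
    define Q where "Q = total_quantity P q"
    define e where "e = 2 * (vec_dist m x x' + vec_dist n y y')"
    have Q: "0 \<le> Q"
      unfolding Q_def by (rule feasible_total_quantity(1)[OF q])
    note f = top_down_feasible[OF xy Q, folded m_def n_def]
      and f' = top_down_feasible[OF xy' Q, folded m_def n_def]
    have e: "\<bar>top_down m n x y Q i j - top_down m n x' y' Q i j\<bar> \<le> e" for i j
      using top_down_lipschitz[of m n x y Q i j x' y' Q] by (simp add: e_def)
    have "stage_value P c s G x y q \<le> stage_value P c s G x y (top_down m n x y Q)"
      using stage_value_le_top_down[OF xy xy dominates_refl dominates_refl q G]
      by (simp add: Q_def m_def n_def)
    also have "\<dots> \<le> stage_value P c s G x' y' (top_down m n x' y' Q) +
        (\<Sum>i=1..m. \<Sum>j=1..n. \<bar>c i + s j\<bar>) * e +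
        L * (vec_dist m x x' + vec_dist n y y' + 2 * real m * real n * e)"
      using stage_value_lipschitz[OF xy xy' f f' e L, of c s, folded m_def n_def] by linarith
    also have "\<dots> = stage_value P c s G x' y' (top_down m n x' y' Q) + K * (vec_dist m x x' + vec_dist n y y')"
      by (simp add: K_def e_def algebra_simps)
    also have "stage_value P c s G x' y' (top_down m n x' y' Q) \<le> stage_sup P c s G x' y'"
      by (rule stage_value_le_stage_sup[OF xy' G L f'])
    finally show "stage_value P c s G x y q \<le> stage_sup P c s G x' y' + K * (vec_dist m x x' + vec_dist n y y')"
      by simp
  qed
  have "lipschitz_states m n (stage_sup P c s G) K"
    unfolding lipschitz_states_def
  proof (intro conjI ballI K)
    fix x x' y y'
    assume *: "x \<in> nonneg_vecs m" "x' \<in> nonneg_vecs m" "y \<in> nonneg_vecs n" "y' \<in> nonneg_vecs n"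
    show "\<bar>stage_sup P c s G x y - stage_sup P c s G x' y'\<bar> \<le> K * (vec_dist m x x' + vec_dist n y y')"
      using le[OF *(1,3,2,4)] le[OF *(2,4,1,3)]
      by (simp add: vec_dist_sym[of m x'] vec_dist_sym[of n y'] abs_le_iff)
  qed
  then show ?thesis
    unfolding m_def n_def by blast
qed

section \<open>Expectation over the arrivals\<close>

definition continuation ::
    "'w matching_model \<Rightarrow> nat \<Rightarrow> ((nat \<Rightarrow> real) \<Rightarrow> (nat \<Rightarrow> real) \<Rightarrow> real) \<Rightarrow>
     (nat \<Rightarrow> real) \<Rightarrow> (nat \<Rightarrow> real) \<Rightarrow> real" where
  "continuation P t W u v =
     (\<integral>\<omega>. W (\<lambda>i. carry_demand P * u i + demand_arr P t \<omega> i)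
             (\<lambda>j. carry_supply P * v j + supply_arr P t \<omega> j) \<partial>(prob_of P))"

text \<open>
  A Lipschitz function is continuous in the product topology on the nonnegative states, which gives
  the measurability of its composition with the arrivals.
\<close>

lemma lipschitz_states_continuous_on:
  assumes "lipschitz_states m n V L"
  shows "continuous_on (nonneg_vecs m \<times> nonneg_vecs n) (\<lambda>z. V (fst z) (snd z))"
  unfolding continuous_on_def
proof
  fix z assume z: "z \<in> nonneg_vecs m \<times> nonneg_vecs n"
  let ?F = "at z within (nonneg_vecs m \<times> nonneg_vecs n)"
  have lim: "((\<lambda>w. L * ((\<Sum>i=1..m. \<bar>fst w i - fst z i\<bar>) + (\<Sum>j=1..n. \<bar>snd w j - snd z j\<bar>)))
      \<longlongrightarrow> L * ((\<Sum>i=1..m. \<bar>fst z i - fst z i\<bar>) + (\<Sum>j=1..n. \<bar>snd z j - snd z j\<bar>))) ?F"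
  proof -
    have "continuous_on UNIV (\<lambda>w :: (nat \<Rightarrow> real) \<times> (nat \<Rightarrow> real).
      L * ((\<Sum>i=1..m. \<bar>fst w i - fst z i\<bar>) + (\<Sum>j=1..n. \<bar>snd w j - snd z j\<bar>)))"
      by (intro continuous_intros continuous_on_product_then_coordinatewise)
    then show ?thesis
      by (meson UNIV_I continuous_on_def subset_UNIV tendsto_within_subset)
  qed
  have "((\<lambda>w. V (fst w) (snd w) - V (fst z) (snd z)) \<longlongrightarrow> 0) ?F"
  proof (rule tendsto_rabs_zero_cancel, rule tendsto_sandwich)
    show "\<forall>\<^sub>F w in ?F. 0 \<le> \<bar>V (fst w) (snd w) - V (fst z) (snd z)\<bar>"
      by simp
    show "\<forall>\<^sub>F w in ?F. \<bar>V (fst w) (snd w) - V (fst z) (snd z)\<bar>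
        \<le> L * ((\<Sum>i=1..m. \<bar>fst w i - fst z i\<bar>) + (\<Sum>j=1..n. \<bar>snd w j - snd z j\<bar>))"
      unfolding eventually_at_filter
    proof (intro always_eventually allI impI)
      fix w assume "w \<in> nonneg_vecs m \<times> nonneg_vecs n"
      then show "\<bar>V (fst w) (snd w) - V (fst z) (snd z)\<bar>
        \<le> L * ((\<Sum>i=1..m. \<bar>fst w i - fst z i\<bar>) + (\<Sum>j=1..n. \<bar>snd w j - snd z j\<bar>))"
        using z assms unfolding lipschitz_states_def vec_dist_def by (auto simp: mem_Times_iff)
    qed
    show "((\<lambda>w. L * ((\<Sum>i=1..m. \<bar>fst w i - fst z i\<bar>) + (\<Sum>j=1..n. \<bar>snd w j - snd z j\<bar>))) \<longlongrightarrow> 0) ?F"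
      using lim by simp
  qed simp
  then show "((\<lambda>w. V (fst w) (snd w)) \<longlongrightarrow> V (fst z) (snd z)) ?F"
    by (simp add: LIM_zero_cancel)
qed

lemma next_states_nonneg:
  assumes P: "valid_model P" and t: "t \<in> {1..horizon P}" and w: "\<omega> \<in> space (prob_of P)"
    and u: "u \<in> nonneg_vecs (n_demand P)" and v: "v \<in> nonneg_vecs (n_supply P)"
  shows "(\<lambda>i. carry_demand P * u i + demand_arr P t \<omega> i) \<in> nonneg_vecs (n_demand P)"
    and "(\<lambda>j. carry_supply P * v j + supply_arr P t \<omega> j) \<in> nonneg_vecs (n_supply P)"
proof -
  have "demand_arr P t \<omega> \<in> nonneg_vecs (n_demand P)" "supply_arr P t \<omega> \<in> nonneg_vecs (n_supply P)"
    "0 \<le> carry_demand P" "0 \<le> carry_supply P"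
    using P t w by (auto simp: valid_model_def)
  then show "(\<lambda>i. carry_demand P * u i + demand_arr P t \<omega> i) \<in> nonneg_vecs (n_demand P)"
    "(\<lambda>j. carry_supply P * v j + supply_arr P t \<omega> j) \<in> nonneg_vecs (n_supply P)"
    using u v by (auto simp: nonneg_vecs_def)
qed

lemma borel_measurable_arrivals:
  fixes A :: "'w \<Rightarrow> nat \<Rightarrow> real"
  assumes "\<And>i. i \<in> {1..k} \<Longrightarrow> integrable M (\<lambda>\<omega>. A \<omega> i)"
    and "\<And>\<omega>. \<omega> \<in> space M \<Longrightarrow> A \<omega> \<in> nonneg_vecs k"
  shows "(\<lambda>\<omega> i. a * u i + A \<omega> i) \<in> borel_measurable M"
proof (rule measurable_coordinatewise_then_product)
  fix i
  have "(\<lambda>\<omega>. A \<omega> i) \<in> borel_measurable M"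
  proof (cases "i \<in> {1..k}")
    case True
    then show ?thesis
      using assms(1) by blast
  next
    case False
    then have "A \<omega> i = 0" if "\<omega> \<in> space M" for \<omega>
      using assms(2)[OF that] by (auto simp: nonneg_vecs_def)
    then show ?thesis
      by (simp cong: measurable_cong)
  qed
  then show "(\<lambda>\<omega>. a * u i + A \<omega> i) \<in> borel_measurable M"
    by simp
qed

lemma integrable_next_value:
  assumes P: "valid_model P" and t: "t \<in> {1..horizon P}"
    and V: "lipschitz_states (n_demand P) (n_supply P) V L"
    and u: "u \<in> nonneg_vecs (n_demand P)" and v: "v \<in> nonneg_vecs (n_supply P)"
  shows "integrable (prob_of P) (\<lambda>\<omega>. V (\<lambda>i. carry_demand P * u i + demand_arr P t \<omega> i)
             (\<lambda>j. carry_supply P * v j + supply_arr P t \<omega> j))"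
proof -
  define M m n where "M = prob_of P" and "m = n_demand P" and "n = n_supply P"
  define a b where "a = carry_demand P" and "b = carry_supply P"
  define X Y where "X = (\<lambda>\<omega> i. a * u i + demand_arr P t \<omega> i)" and "Y = (\<lambda>\<omega> j. b * v j + supply_arr P t \<omega> j)"
  interpret prob_space M
    using P by (simp add: valid_model_def M_def)
  have D: "integrable M (\<lambda>\<omega>. demand_arr P t \<omega> i)" if "i \<in> {1..m}" for i
    using P t that by (auto simp: valid_model_def M_def m_def)
  have S: "integrable M (\<lambda>\<omega>. supply_arr P t \<omega> j)" if "j \<in> {1..n}" for j
    using P t that by (auto simp: valid_model_def M_def n_def)
  have states: "X \<omega> \<in> nonneg_vecs m" "Y \<omega> \<in> nonneg_vecs n" if "\<omega> \<in> space M" for \<omega>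
    using next_states_nonneg[OF P t _ u v] that
    by (simp_all add: X_def Y_def a_def b_def M_def m_def n_def)
  have arr: "demand_arr P t \<omega> \<in> nonneg_vecs m" "supply_arr P t \<omega> \<in> nonneg_vecs n"
    if "\<omega> \<in> space M" for \<omega>
    using P t that by (auto simp: valid_model_def M_def m_def n_def)
  have [measurable]: "X \<in> borel_measurable M" "Y \<in> borel_measurable M"
    unfolding X_def Y_def
    by (rule borel_measurable_arrivals[OF D arr(1)] borel_measurable_arrivals[OF S arr(2)]; assumption)+
  have "(\<lambda>\<omega>. (X \<omega>, Y \<omega>)) \<in> M \<rightarrow>\<^sub>M restrict_space borel (nonneg_vecs m \<times> nonneg_vecs n)"
    by (rule measurable_restrict_space2) (use states in auto)
  from measurable_compose[OF this borel_measurable_continuous_on_restrict[OF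
      lipschitz_states_continuous_on[OF V[folded m_def n_def]]]]
  have meas: "(\<lambda>\<omega>. V (X \<omega>) (Y \<omega>)) \<in> borel_measurable M"
    by simp
  \<comment> \<open>Comparing with the value at the zero state bounds the integrand by the integrable arrivals.\<close>
  have zero: "(\<lambda>_. 0) \<in> nonneg_vecs k" for k
    by (simp add: nonneg_vecs_def)
  have bound: "\<bar>V (X \<omega>) (Y \<omega>)\<bar> \<le> \<bar>V (\<lambda>_. 0) (\<lambda>_. 0)\<bar> +
      L * ((\<Sum>i=1..m. \<bar>X \<omega> i\<bar>) + (\<Sum>j=1..n. \<bar>Y \<omega> j\<bar>))" if "\<omega> \<in> space M" for \<omega>
  proof -
    have "\<bar>V (X \<omega>) (Y \<omega>) - V (\<lambda>_. 0) (\<lambda>_. 0)\<bar> \<le>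
        L * (vec_dist m (X \<omega>) (\<lambda>_. 0) + vec_dist n (Y \<omega>) (\<lambda>_. 0))"
      using V states[OF that] zero unfolding lipschitz_states_def m_def n_def by blast
    then show ?thesis
      by (simp add: vec_dist_def)
  qed
  have "integrable M (\<lambda>\<omega>. \<bar>V (\<lambda>_. 0) (\<lambda>_. 0)\<bar> + L * ((\<Sum>i=1..m. \<bar>X \<omega> i\<bar>) + (\<Sum>j=1..n. \<bar>Y \<omega> j\<bar>)))"
    unfolding X_def Y_def using D S
    by (intro Bochner_Integration.integrable_add integrable_const integrable_mult_right
        Bochner_Integration.integrable_sum integrable_abs) auto
  then have "integrable M (\<lambda>\<omega>. V (X \<omega>) (Y \<omega>))"
  proof (rule Bochner_Integration.integrable_bound[OF _ meas])
    show "AE \<omega> in M. norm (V (X \<omega>) (Y \<omega>)) \<le>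
        norm (\<bar>V (\<lambda>_. 0) (\<lambda>_. 0)\<bar> + L * ((\<Sum>i=1..m. \<bar>X \<omega> i\<bar>) + (\<Sum>j=1..n. \<bar>Y \<omega> j\<bar>)))"
    proof (rule AE_I2)
      fix \<omega> assume "\<omega> \<in> space M"
      then show "norm (V (X \<omega>) (Y \<omega>)) \<le>
          norm (\<bar>V (\<lambda>_. 0) (\<lambda>_. 0)\<bar> + L * ((\<Sum>i=1..m. \<bar>X \<omega> i\<bar>) + (\<Sum>j=1..n. \<bar>Y \<omega> j\<bar>)))"
        using bound[of \<omega>] unfolding real_norm_def by linarith
    qed
  qed
  then show ?thesis
    by (simp add: M_def X_def Y_def a_def b_def)
qed

lemma continuation_le:
  assumes P: "valid_model P" and t: "t \<in> {1..horizon P}"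
    and V: "lipschitz_states (n_demand P) (n_supply P) V L"
    and u: "u \<in> nonneg_vecs (n_demand P)" and v: "v \<in> nonneg_vecs (n_supply P)"
    and u': "u' \<in> nonneg_vecs (n_demand P)" and v': "v' \<in> nonneg_vecs (n_supply P)"
    and le: "\<And>\<omega>. \<omega> \<in> space (prob_of P) \<Longrightarrow>
       V (\<lambda>i. carry_demand P * u' i + demand_arr P t \<omega> i) (\<lambda>j. carry_supply P * v' j + supply_arr P t \<omega> j)
       \<le> V (\<lambda>i. carry_demand P * u i + demand_arr P t \<omega> i) (\<lambda>j. carry_supply P * v j + supply_arr P t \<omega> j) + B"
  shows "continuation P t V u' v' \<le> continuation P t V u v + B"
proof -
  interpret prob_space "prob_of P"
    using P by (simp add: valid_model_def)
  note int = integrable_next_value[OF P t V u v] and int' = integrable_next_value[OF P t V u' v']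
  have "continuation P t V u' v' \<le> (\<integral>\<omega>. V (\<lambda>i. carry_demand P * u i + demand_arr P t \<omega> i)
             (\<lambda>j. carry_supply P * v j + supply_arr P t \<omega> j) + B \<partial>(prob_of P))"
    unfolding continuation_def using le
    by (intro integral_mono int' Bochner_Integration.integrable_add int integrable_const)
  also have "\<dots> = continuation P t V u v + B"
    unfolding continuation_def using int by (simp add: prob_space)
  finally show ?thesis .
qed

lemma vec_dist_next_state:
  assumes "0 \<le> a" and "a \<le> 1"
  shows "vec_dist k (\<lambda>i. a * u i + d i) (\<lambda>i. a * u' i + d i) \<le> vec_dist k u u'"
proof -
  have "\<bar>a * u i + d i - (a * u' i + d i)\<bar> \<le> \<bar>u i - u' i\<bar>" for i
  proof -
    have "\<bar>a * u i + d i - (a * u' i + d i)\<bar> = a * \<bar>u i - u' i\<bar>"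
      using assms(1) by (simp add: abs_mult right_diff_distrib[symmetric])
    then show ?thesis
      using mult_right_mono[OF assms(2), of "\<bar>u i - u' i\<bar>"] by simp
  qed
  then show ?thesis
    unfolding vec_dist_def by (intro sum_mono)
qed

lemma lipschitz_continuation:
  assumes P: "valid_model P" and t: "t \<in> {1..horizon P}"
    and V: "lipschitz_states (n_demand P) (n_supply P) V L"
  shows "lipschitz_states (n_demand P) (n_supply P) (continuation P t V) L"
proof -
  define m n where "m = n_demand P" and "n = n_supply P"
  have ab: "0 \<le> carry_demand P" "carry_demand P \<le> 1" "0 \<le> carry_supply P" "carry_supply P \<le> 1"
    using P by (auto simp: valid_model_def)
  have "0 \<le> L"
    using V by (simp add: lipschitz_states_def)
  have le: "continuation P t V u' v' \<le> continuation P t V u v + L * (vec_dist m u u' + vec_dist n v v')"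
    if uv: "u \<in> nonneg_vecs m" "v \<in> nonneg_vecs n" "u' \<in> nonneg_vecs m" "v' \<in> nonneg_vecs n"
    for u u' v v'
  proof (rule continuation_le[OF P t V uv[unfolded m_def n_def]])
    fix \<omega> assume w: "\<omega> \<in> space (prob_of P)"
    let ?x = "\<lambda>u i. carry_demand P * u i + demand_arr P t \<omega> i"
    let ?y = "\<lambda>v j. carry_supply P * v j + supply_arr P t \<omega> j"
    have "\<bar>V (?x u) (?y v) - V (?x u') (?y v')\<bar> \<le>
        L * (vec_dist m (?x u) (?x u') + vec_dist n (?y v) (?y v'))"
      using V next_states_nonneg[OF P t w uv(1,2)[unfolded m_def n_def]]
        next_states_nonneg[OF P t w uv(3,4)[unfolded m_def n_def]]
      unfolding lipschitz_states_def m_def n_def by blast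
    also have "\<dots> \<le> L * (vec_dist m u u' + vec_dist n v v')"
      using ab \<open>0 \<le> L\<close> by (intro mult_left_mono add_mono vec_dist_next_state)
    finally show "V (?x u') (?y v') \<le> V (?x u) (?y v) + L * (vec_dist m u u' + vec_dist n v v')"
      by linarith
  qed
  show ?thesis
    unfolding lipschitz_states_def m_def[symmetric] n_def[symmetric]
  proof (intro conjI ballI \<open>0 \<le> L\<close>)
    fix u u' v v'
    assume *: "u \<in> nonneg_vecs m" "u' \<in> nonneg_vecs m" "v \<in> nonneg_vecs n" "v' \<in> nonneg_vecs n"
    show "\<bar>continuation P t V u v - continuation P t V u' v'\<bar> \<le> L * (vec_dist m u u' + vec_dist n v v')"
      using le[OF *(1,3,2,4)] le[OF *(2,4,1,3)]
      by (simp add: vec_dist_sym[of m u'] vec_dist_sym[of n v'] abs_le_iff)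
  qed
qed

lemma dominates_next_state:
  assumes "0 \<le> a" and "dominates k u' u"
  shows "dominates k (\<lambda>i. a * u' i + d i) (\<lambda>i. a * u i + d i)"
proof -
  have "cum (\<lambda>i. a * u i + d i) i = a * cum u i + cum d i" for u i
    by (simp add: cum_def sum.distrib sum_distrib_left)
  then show ?thesis
    using assms by (auto simp: dominates_def intro: mult_left_mono)
qed

text \<open>
  This is where the assumption on the discounted quality gaps enters: an upgrade kept for the next
  period survives with the carry-over factor and is then worth the reward difference of that period,
  which is at most the reward difference of the present one.
\<close>

lemma upgrade_bounded_continuation:
  assumes P: "valid_model P" and t: "t \<in> {1..horizon P}"
    and L: "lipschitz_states (n_demand P) (n_supply P) V L"
    and V: "upgrade_bounded (n_demand P) (n_supply P) c' s' V"
    and c: "\<And>i. i \<in> {1..<n_demand P} \<Longrightarrow> carry_demand P * (c' i - c' (i + 1)) \<le> c i - c (i + 1)"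
    and s: "\<And>j. j \<in> {1..<n_supply P} \<Longrightarrow> carry_supply P * (s' j - s' (j + 1)) \<le> s j - s (j + 1)"
  shows "upgrade_bounded (n_demand P) (n_supply P) c s (continuation P t V)"
  unfolding upgrade_bounded_def add.assoc
proof (intro ballI impI)
  fix u u' v v'
  assume u: "u \<in> nonneg_vecs (n_demand P)" and v: "v \<in> nonneg_vecs (n_supply P)"
    and u': "u' \<in> nonneg_vecs (n_demand P)" and v': "v' \<in> nonneg_vecs (n_supply P)"
    and domu: "dominates (n_demand P) u' u" and domv: "dominates (n_supply P) v' v"
  define a b where "a = carry_demand P" and "b = carry_supply P"
  have ab: "0 \<le> a" "0 \<le> b"
    using P by (auto simp: valid_model_def a_def b_def)
  have "0 \<le> (\<Sum>i=1..n_demand P. (c i - a * c' i) * (u' i - u i))"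
    using c by (intro dominates_weighted_sum[OF domu]) (simp add: a_def algebra_simps)
  then have cu: "(\<Sum>i=1..n_demand P. c' i * (a * u' i - a * u i)) \<le> (\<Sum>i=1..n_demand P. c i * (u' i - u i))"
    by (simp add: algebra_simps sum_subtractf sum.distrib)
  have "0 \<le> (\<Sum>j=1..n_supply P. (s j - b * s' j) * (v' j - v j))"
    using s by (intro dominates_weighted_sum[OF domv]) (simp add: b_def algebra_simps)
  then have sv: "(\<Sum>j=1..n_supply P. s' j * (b * v' j - b * v j)) \<le> (\<Sum>j=1..n_supply P. s j * (v' j - v j))"
    by (simp add: algebra_simps sum_subtractf sum.distrib)
  show "continuation P t V u' v' \<le> continuation P t V u v +
      ((\<Sum>i=1..n_demand P. c i * (u' i - u i)) + (\<Sum>j=1..n_supply P. s j * (v' j - v j)))"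
  proof (rule continuation_le[OF P t L u v u' v'], fold a_def b_def)
    fix \<omega> assume w: "\<omega> \<in> space (prob_of P)"
    let ?x = "\<lambda>u i. a * u i + demand_arr P t \<omega> i"
    let ?y = "\<lambda>v j. b * v j + supply_arr P t \<omega> j"
    have "V (?x u') (?y v') \<le> V (?x u) (?y v) +
        (\<Sum>i=1..n_demand P. c' i * (?x u' i - ?x u i)) + (\<Sum>j=1..n_supply P. s' j * (?y v' j - ?y v j))"
      using V next_states_nonneg[OF P t w u v, folded a_def b_def]
        next_states_nonneg[OF P t w u' v', folded a_def b_def]
        dominates_next_state[OF ab(1) domu, of "demand_arr P t \<omega>"]
        dominates_next_state[OF ab(2) domv, of "supply_arr P t \<omega>"]
      unfolding upgrade_bounded_def by blast
    then show "V (?x u') (?y v') \<le> V (?x u) (?y v) +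
        ((\<Sum>i=1..n_demand P. c i * (u' i - u i)) + (\<Sum>j=1..n_supply P. s j * (v' j - v j)))"
      using cu sv by simp
  qed
qed

section \<open>Backward induction\<close>

lemma objective_eq_stage_value:
  assumes "vertical_rewards P rd rs" and "t \<in> {1..horizon P}"
  shows "objective P t W = stage_value P (rd t) (rs t) (continuation P (t + 1) W)"
proof (intro ext)
  fix x y q
  have "(\<Sum>i=1..n_demand P. \<Sum>j=1..n_supply P. reward P t i j * q i j) =
        (\<Sum>i=1..n_demand P. \<Sum>j=1..n_supply P. (rd t i + rs t j) * q i j)"
    using assms by (intro sum.cong refl) (simp add: vertical_rewards_def)
  then show "objective P t W x y q = stage_value P (rd t) (rs t) (continuation P (t + 1) W) x y q"
    by (simp add: objective_def stage_value_def continuation_def)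
qed

lemma value_fun_eq_stage_sup:
  assumes "vertical_rewards P rd rs" and "t \<in> {1..horizon P}"
  shows "value_fun P t =
         stage_sup P (rd t) (rs t) (continuation P (t + 1) (value_fun P (t + 1)))"
  using assms(2)
  by (subst value_fun.simps) (simp add: objective_eq_stage_value[OF assms] stage_sup_def fun_eq_iff)

text \<open>
  In the last period the continuation vanishes and the upgrade bound only says that better types earn
  more.
\<close>

lemma continuation_value_fun_regular:
  assumes P: "valid_model P" and vert: "vertical_rewards P rd rs"
    and gaps: "discounted_quality_gaps P rd rs" and t: "t \<in> {1..horizon P}"
  shows "upgrade_bounded (n_demand P) (n_supply P) (rd t) (rs t)
           (continuation P (t + 1) (value_fun P (t + 1))) \<and>
         (\<exists>L. lipschitz_states (n_demand P) (n_supply P)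
           (continuation P (t + 1) (value_fun P (t + 1))) L)"
  using t
proof (induction "horizon P - t" arbitrary: t)
  case 0
  then have t: "t = horizon P"
    by simp
  then have zero: "continuation P (t + 1) (value_fun P (t + 1)) = (\<lambda>_ _. 0)"
    by (simp add: continuation_def value_fun.simps fun_eq_iff)
  have c: "rd t (i + 1) \<le> rd t i" if "i \<in> {1..<n_demand P}" for i
    using vert 0(2) that by (auto simp: vertical_rewards_def intro: less_imp_le)
  have s: "rs t (j + 1) \<le> rs t j" if "j \<in> {1..<n_supply P}" for j
    using vert 0(2) that by (auto simp: vertical_rewards_def intro: less_imp_le)
  have "upgrade_bounded (n_demand P) (n_supply P) (rd t) (rs t) (\<lambda>_ _. 0)"
    unfolding upgrade_bounded_def
    using dominates_weighted_sum[where c = "rd t", OF _ c] dominates_weighted_sum[where c = "rs t", OF _ s]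
    by (auto intro: add_nonneg_nonneg)
  moreover have "lipschitz_states (n_demand P) (n_supply P) (\<lambda>_ _. 0) 0"
    by (simp add: lipschitz_states_def)
  ultimately show ?case
    unfolding zero by blast
next
  case (Suc k)
  define G where "G = continuation P (t + 1 + 1) (value_fun P (t + 1 + 1))"
  have t1: "t + 1 \<in> {1..horizon P}" and tlt: "t \<in> {1..<horizon P}"
    using Suc by auto
  have "k = horizon P - (t + 1)"
    using Suc(2) by simp
  from Suc(1)[OF this t1] obtain L
    where G: "upgrade_bounded (n_demand P) (n_supply P) (rd (t + 1)) (rs (t + 1)) G"
      and L: "lipschitz_states (n_demand P) (n_supply P) G L"
    unfolding G_def by blast
  have V: "value_fun P (t + 1) = stage_sup P (rd (t + 1)) (rs (t + 1)) G"
    unfolding G_def by (rule value_fun_eq_stage_sup[OF vert t1])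
  obtain K where K: "lipschitz_states (n_demand P) (n_supply P) (value_fun P (t + 1)) K"
    using lipschitz_stage_sup[OF G L] unfolding V by blast
  have U: "upgrade_bounded (n_demand P) (n_supply P) (rd (t + 1)) (rs (t + 1)) (value_fun P (t + 1))"
    unfolding V by (rule upgrade_bounded_stage_sup[OF G L])
  have "upgrade_bounded (n_demand P) (n_supply P) (rd t) (rs t)
      (continuation P (t + 1) (value_fun P (t + 1)))"
    using gaps tlt by (intro upgrade_bounded_continuation[OF P t1 K U])
      (auto simp: discounted_quality_gaps_def)
  then show ?case
    using lipschitz_continuation[OF P t1 K] by blast
qed

theorem proposition8:
  fixes P :: "'w matching_model" and rd rs :: "nat \<Rightarrow> nat \<Rightarrow> real"
  assumes "valid_model P"
    and "vertical_rewards P rd rs"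
    and "discounted_quality_gaps P rd rs"
  shows "\<exists>\<pi>. optimal_policy P \<pi> \<and>
           (\<forall>t\<in>{1..horizon P}. \<forall>x\<in>nonneg_vecs (n_demand P). \<forall>y\<in>nonneg_vecs (n_supply P).
              top_down_matching P x y (\<pi> t x y) \<and>
              (\<forall>i\<in>{1..n_demand P}. \<forall>j\<in>{1..n_supply P}.
                 \<pi> t x y i j =
                   max 0 (min (min (cum x i) (cum y j)) (total_quantity P (\<pi> t x y))
                          - max (cum x (i - 1)) (cum y (j - 1)))))"
proof -
  define optimal where "optimal = (\<lambda>t x y Q. \<forall>q\<in>feasible P x y.
    objective P t (value_fun P (t + 1)) x y q \<le>
    objective P t (value_fun P (t + 1)) x y (top_down (n_demand P) (n_supply P) x y Q))"
  define Qopt where "Qopt = (\<lambda>t x y. SOME Q. 0 \<le> Q \<and> optimal t x y Q)"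
  define \<pi> where "\<pi> = (\<lambda>t x y. top_down (n_demand P) (n_supply P) x y (Qopt t x y))"
  have Qopt: "0 \<le> Qopt t x y \<and> optimal t x y (Qopt t x y)"
    if t: "t \<in> {1..horizon P}" and x: "x \<in> nonneg_vecs (n_demand P)" and y: "y \<in> nonneg_vecs (n_supply P)"
    for t x y
  proof -
    have "\<exists>Q. 0 \<le> Q \<and> optimal t x y Q"
      unfolding optimal_def objective_eq_stage_value[OF assms(2) t]
      using continuation_value_fun_regular[OF assms t] ex_optimal_top_down[OF x y] by blast
    then show ?thesis
      unfolding Qopt_def by (rule someI_ex)
  qed
  have "optimal_policy P \<pi>"
    unfolding optimal_policy_def
  proof (intro ballI conjI)
    fix t x y
    assume *: "t \<in> {1..horizon P}" "x \<in> nonneg_vecs (n_demand P)" "y \<in> nonneg_vecs (n_supply P)"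
    show "\<pi> t x y \<in> feasible P x y"
      unfolding \<pi>_def using top_down_feasible[OF *(2,3)] Qopt[OF *] by blast
    fix q assume "q \<in> feasible P x y"
    then show "objective P t (value_fun P (t + 1)) x y q \<le> objective P t (value_fun P (t + 1)) x y (\<pi> t x y)"
      using Qopt[OF *] unfolding \<pi>_def optimal_def by blast
  qed
  moreover have "top_down_matching P x y (\<pi> t x y) \<and>
      (\<forall>i\<in>{1..n_demand P}. \<forall>j\<in>{1..n_supply P}.
         \<pi> t x y i j = max 0 (min (min (cum x i) (cum y j)) (total_quantity P (\<pi> t x y))
                          - max (cum x (i - 1)) (cum y (j - 1))))"
    if "t \<in> {1..horizon P}" "x \<in> nonneg_vecs (n_demand P)" "y \<in> nonneg_vecs (n_supply P)" for t x y
    unfolding \<pi>_def using Qopt[OF that] that(2,3)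
    by (blast intro: top_down_matching_top_down top_down_formula)
  ultimately show ?thesis
    by blast
qed

end
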